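(* Let $\beta$ be a constant positive integer. In $(0,\beta)$-HEGs, a Nash stable partition can be found in polynomial time via imitative better response dynamics: given a $(0,\beta)$-HEG instance $\mathcal{G} = (N, S, e, \kappa)$, imitative better response dynamics started from any partition in which every coalition has size exactly $\kappa$, except possibly for one coalition, reaches a Nash stable partition after $O(|N| \cdot |S|)$ moves (with the $O(\cdot)$ constant depending only on $\beta$).
   Context: A hedonic expertise game (HEG) is $\mathcal{G} = (N, S, e, \kappa)$, where $N$ is a finite set of agents, $S$ is a finite set of skills, for each agent $i \in N$ there is a non-negative real-valued expertise function $e_i$ on $S$, and $\kappa$ is a positive integer (upper bound on coalition sizes). A $(0,\beta)$-HEG is an HEG with $e_i : S \to \{0, 1, \ldots, \beta\}$ for all $i \in N$. For a nonempty $C \subseteq N$ let $E_C(s) = \max_{i \in C} e_i(s)$ and define the joint utility $U(C) = \sum_{s \in S} E_C(s)$; by convention $U(\emptyset) = 0$. A coalition is a nonempty subset of $N$ of size at most $\kappa$. A solution is a partition $\pi$ of $N$ into coalitions; all partitions considered are of this kind. $\pi(i)$ denotes the coalition of $\pi$ containing $i$. A partition $\pi$ is Nash stable if for every agent $i \in N$ and every $C \in \pi$ with $|C| < \kappa$ we have $U(\pi(i)) \ge U(C \cup \{i\})$. A better response of agent $i$ in $\pi$ is a move of $i$ to some $C \in \pi$ with $|C| < \kappa$ and $U(C \cup \{i\}) > U(\pi(i))$; the resulting partition is obtained from $\pi$ by replacing $C$ with $C \cup \{i\}$ and $\pi(i)$ with $\pi(i) \setminus \{i\}$ (discarded if empty).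 Imitative better response dynamics: while the current partition is not Nash stable, agents move one at a time. If the last agent to move, $i$, moved from its coalition $D$ to a coalition $C$ and $|C \cup \{i\}| < \kappa$, then the next move is made by an arbitrary agent $i' \in D \setminus \{i\}$, who "imitates" $i$ by moving to the same coalition $C \cup \{i\}$ (this is again a better response for $i'$), and so on until the target coalition has size $\kappa$. Otherwise, an arbitrary agent with a better response takes an arbitrary better response. Each relocation of a single agent counts as one move. *)

theory Defs
  imports
    Complex_Main
    "HOL-Library.Disjoint_Sets"
    "HOL-Library.Time_Functions"
    "HOL-Computational_Algebra.Polynomial"
begin

section \<open>Hedonic expertise games\<close>

record ('a, 's) heg =
  agents :: "'a set"
  skills :: "'s set"
  expertise :: "'a \<Rightarrow> 's \<Rightarrow> real"
  max_size :: nat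

definition is_heg :: "('a, 's) heg \<Rightarrow> bool" where
  "is_heg G \<longleftrightarrow> finite (agents G) \<and> finite (skills G) \<and> 0 < max_size G \<and>
     (\<forall>i\<in>agents G. \<forall>s\<in>skills G. 0 \<le> expertise G i s)"

definition is_zero_beta_heg :: "nat \<Rightarrow> ('a, 's) heg \<Rightarrow> bool" where
  "is_zero_beta_heg \<beta> G \<longleftrightarrow> is_heg G \<and>
     (\<forall>i\<in>agents G. \<forall>s\<in>skills G. expertise G i s \<in> real ` {0..\<beta>})"

definition joint_expertise :: "('a, 's) heg \<Rightarrow> 'a set \<Rightarrow> 's \<Rightarrow> real" where
  "joint_expertise G C s = Max ((\<lambda>i. expertise G i s) ` C)"

definition joint_utility :: "('a, 's) heg \<Rightarrow> 'a set \<Rightarrow> real" where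
  "joint_utility G C = (if C = {} then 0 else (\<Sum>s\<in>skills G. joint_expertise G C s))"

definition is_coalition :: "('a, 's) heg \<Rightarrow> 'a set \<Rightarrow> bool" where
  "is_coalition G C \<longleftrightarrow> C \<subseteq> agents G \<and> C \<noteq> {} \<and> card C \<le> max_size G"

definition is_solution :: "('a, 's) heg \<Rightarrow> 'a set set \<Rightarrow> bool" where
  "is_solution G \<pi> \<longleftrightarrow> partition_on (agents G) \<pi> \<and> (\<forall>C\<in>\<pi>. is_coalition G C)"

definition coalition_of :: "'a set set \<Rightarrow> 'a \<Rightarrow> 'a set" where
  "coalition_of \<pi> i = (THE C. C \<in> \<pi> \<and> i \<in> C)"

definition nash_stable :: "('a, 's) heg \<Rightarrow> 'a set set \<Rightarrow> bool" where
  "nash_stable G \<pi> \<longleftrightarrow>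
     (\<forall>i\<in>agents G. \<forall>C\<in>\<pi>. card C < max_size G \<longrightarrow>
        joint_utility G (C \<union> {i}) \<le> joint_utility G (coalition_of \<pi> i))"

text \<open>Every coalition has the maximal size, except possibly one.\<close>

definition almost_full :: "('a, 's) heg \<Rightarrow> 'a set set \<Rightarrow> bool" where
  "almost_full G \<pi> \<longleftrightarrow> (\<exists>D. \<forall>C\<in>\<pi>. C \<noteq> D \<longrightarrow> card C = max_size G)"


section \<open>Imitative better response dynamics\<close>

definition better_response :: "('a, 's) heg \<Rightarrow> 'a set set \<Rightarrow> 'a \<Rightarrow> 'a set \<Rightarrow> bool" where
  "better_response G \<pi> i C \<longleftrightarrow> i \<in> agents G \<and> C \<in> \<pi> \<and> card C < max_size G \<and>
     joint_utility G (coalition_of \<pi> i) < joint_utility G (C \<union> {i})"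

definition relocate :: "'a set set \<Rightarrow> 'a \<Rightarrow> 'a set \<Rightarrow> 'a set set" where
  "relocate \<pi> i C =
     (\<pi> - {C, coalition_of \<pi> i}) \<union> {C \<union> {i}} \<union> ({coalition_of \<pi> i - {i}} - {{}})"

text \<open>
  A state consists of the current partition and the last move, if any. A move (i, D, C) records
  the agent i together with its coalition D and the target coalition C, both taken before the move.
\<close>

type_synonym 'a move = "'a \<times> 'a set \<times> 'a set"

type_synonym 'a state = "'a set set \<times> 'a move option"

fun must_imitate :: "('a, 's) heg \<Rightarrow> 'a move option \<Rightarrow> bool" where
  "must_imitate G None \<longleftrightarrow> False"
| "must_imitate G (Some (i, D, C)) \<longleftrightarrow> card (C \<union> {i}) < max_size G"

inductive imitative_step :: "('a, 's) heg \<Rightarrow> 'a state \<Rightarrow> 'a state \<Rightarrow> bool" for G where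
  free:
    "\<lbrakk>\<not> nash_stable G \<pi>; \<not> must_imitate G last_move; better_response G \<pi> i C\<rbrakk> \<Longrightarrow>
     imitative_step G (\<pi>, last_move) (relocate \<pi> i C, Some (i, coalition_of \<pi> i, C))"
| imitation:
    "\<lbrakk>\<not> nash_stable G \<pi>; must_imitate G (Some (j, D, C)); i \<in> D - {j}\<rbrakk> \<Longrightarrow>
     imitative_step G (\<pi>, Some (j, D, C))
       (relocate \<pi> i (C \<union> {j}), Some (i, coalition_of \<pi> i, C \<union> {j}))"

text \<open>The state (P, l) is reached from the partition Q in exactly t moves.\<close>

abbreviation reaches_in ::
  "('a, 's) heg \<Rightarrow> 'a set set \<Rightarrow> nat \<Rightarrow> 'a set set \<Rightarrow> 'a move option \<Rightarrow> bool" where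
  "reaches_in G Q t P l \<equiv> (imitative_step G ^^ t) (Q, None) (P, l)"


section \<open>A timed implementation of the dynamics\<close>

text \<open>
  An instance is given by its expertise matrix M (row i lists the expertise values of agent i),
  the number m of skills and the size bound. A partition is represented by a pair (C, Fs), where
  C is the coalition that is not full (empty if there is none) and Fs lists the full coalitions.
\<close>

definition matrix_heg :: "nat list list \<Rightarrow> nat \<Rightarrow> nat \<Rightarrow> (nat, nat) heg" where
  "matrix_heg M m \<kappa> =
     \<lparr>agents = {..<length M}, skills = {..<m}, expertise = (\<lambda>i s. real (M ! i ! s)), max_size = \<kappa>\<rparr>"

definition is_matrix_instance :: "nat \<Rightarrow> nat list list \<Rightarrow> nat \<Rightarrow> nat \<Rightarrow> bool" where
  "is_matrix_instance \<beta> M m \<kappa> \<longleftrightarrow>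
     0 < \<kappa> \<and> (\<forall>row\<in>set M. length row = m \<and> set row \<subseteq> {0..\<beta>})"

type_synonym list_partition = "nat list \<times> nat list list"

fun coalitions :: "list_partition \<Rightarrow> nat set set" where
  "coalitions (C, Fs) = set ` set (C # Fs) - {{}}"

text \<open>
  Each function is followed by its running-time function, which has the form that the commands of
  \<^theory>\<open>HOL-Library.Time_Commands\<close> generate from the function: every call of a recursive
  function counts one step, and arithmetic, comparisons and constructors on numbers are free.
\<close>

fun vec_max :: "nat list \<Rightarrow> nat list \<Rightarrow> nat list" where
  "vec_max [] ys = ys"
| "vec_max (x # xs) [] = x # xs"
| "vec_max (x # xs) (y # ys) = max x y # vec_max xs ys"

fun T_vec_max :: "nat list \<Rightarrow> nat list \<Rightarrow> nat" where
  "T_vec_max [] ys = 1"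
| "T_vec_max (x # xs) [] = 1"
| "T_vec_max (x # xs) (y # ys) = T_vec_max xs ys + 1"

fun joint_row :: "nat list list \<Rightarrow> nat list \<Rightarrow> nat list" where
  "joint_row M [] = []"
| "joint_row M (i # C) = vec_max (M ! i) (joint_row M C)"

fun T_joint_row :: "nat list list \<Rightarrow> nat list \<Rightarrow> nat" where
  "T_joint_row M [] = 1"
| "T_joint_row M (i # C) =
     T_nth M i + (T_joint_row M C + T_vec_max (M ! i) (joint_row M C)) + 1"

fun total :: "nat list \<Rightarrow> nat" where
  "total [] = 0"
| "total (x # xs) = x + total xs"

fun T_total :: "nat list \<Rightarrow> nat" where
  "T_total [] = 1"
| "T_total (x # xs) = T_total xs + 1"

fun utility :: "nat list list \<Rightarrow> nat list \<Rightarrow> nat" where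
  "utility M C = total (joint_row M C)"

fun T_utility :: "nat list list \<Rightarrow> nat list \<Rightarrow> nat" where
  "T_utility M C = T_joint_row M C + T_total (joint_row M C)"

text \<open>The first agent of the last argument whose joining C yields utility above u.\<close>

fun find_agent :: "nat list list \<Rightarrow> nat list \<Rightarrow> nat \<Rightarrow> nat list \<Rightarrow> nat option" where
  "find_agent M C u [] = None"
| "find_agent M C u (i # D) = (if u < utility M (i # C) then Some i else find_agent M C u D)"

fun T_find_agent :: "nat list list \<Rightarrow> nat list \<Rightarrow> nat \<Rightarrow> nat list \<Rightarrow> nat" where
  "T_find_agent M C u [] = 1"
| "T_find_agent M C u (i # D) =
     T_utility M (i # C) + (if u < utility M (i # C) then 0 else T_find_agent M C u D) + 1"

fun delete :: "nat \<Rightarrow> nat list \<Rightarrow> nat list" where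
  "delete i [] = []"
| "delete i (j # D) = (if i = j then D else j # delete i D)"

fun T_delete :: "nat \<Rightarrow> nat list \<Rightarrow> nat" where
  "T_delete i [] = 1"
| "T_delete i (j # D) = (if i = j then 0 else T_delete i D) + 1"

text \<open>Agents leave the last argument for C until C has the maximal size.\<close>

fun imitate :: "nat \<Rightarrow> nat list \<Rightarrow> nat list \<Rightarrow> nat list \<times> nat list" where
  "imitate \<kappa> C [] = ([], C)"
| "imitate \<kappa> C (i # D) = (if length C < \<kappa> then imitate \<kappa> (i # C) D else (i # D, C))"

fun T_imitate :: "nat \<Rightarrow> nat list \<Rightarrow> nat list \<Rightarrow> nat" where
  "T_imitate \<kappa> C [] = 1"
| "T_imitate \<kappa> C (i # D) =
     T_length C + (if length C < \<kappa> then T_imitate \<kappa> (i # C) D else 0) + 1"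

text \<open>
  One better response into C, from the first full coalition that has one, and all its imitations.
\<close>

fun phase :: "nat list list \<Rightarrow> nat \<Rightarrow> nat list \<Rightarrow> nat list list \<Rightarrow> list_partition option" where
  "phase M \<kappa> C [] = None"
| "phase M \<kappa> C (D # Fs) =
     (case find_agent M C (utility M D) D of
        Some i \<Rightarrow> (case imitate \<kappa> (i # C) (delete i D) of (D', C') \<Rightarrow> Some (D', C' # Fs))
      | None \<Rightarrow> (case phase M \<kappa> C Fs of
                   Some (C', Fs') \<Rightarrow> Some (C', D # Fs')
                 | None \<Rightarrow> None))"

fun T_phase :: "nat list list \<Rightarrow> nat \<Rightarrow> nat list \<Rightarrow> nat list list \<Rightarrow> nat" where
  "T_phase M \<kappa> C [] = 1"
| "T_phase M \<kappa> C (D # Fs) =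
     T_utility M D + T_find_agent M C (utility M D) D +
     (case find_agent M C (utility M D) D of
        None \<Rightarrow> T_phase M \<kappa> C Fs
      | Some i \<Rightarrow> T_delete i D + T_imitate \<kappa> (i # C) (delete i D)) + 1"

partial_function (tailrec) run_phases ::
  "nat list list \<Rightarrow> nat \<Rightarrow> nat list \<Rightarrow> nat list list \<Rightarrow> list_partition" where
  "run_phases M \<kappa> C Fs =
     (if C = [] then (C, Fs)
      else (case phase M \<kappa> C Fs of
              None \<Rightarrow> (C, Fs)
            | Some (C', Fs') \<Rightarrow> run_phases M \<kappa> C' Fs'))"

text \<open>The value None means that the computation does not terminate.\<close>

partial_function (option) T_run_phases ::
  "nat list list \<Rightarrow> nat \<Rightarrow> nat list \<Rightarrow> nat list list \<Rightarrow> nat option" where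
  "T_run_phases M \<kappa> C Fs =
     (if C = [] then Some 1
      else (case phase M \<kappa> C Fs of
              None \<Rightarrow> Some (T_phase M \<kappa> C Fs + 1)
            | Some (C', Fs') \<Rightarrow>
                Option.bind (T_run_phases M \<kappa> C' Fs') (\<lambda>t. Some (T_phase M \<kappa> C Fs + t + 1))))"

text \<open>The initial partition of the agents below n.\<close>

fun blocks :: "nat \<Rightarrow> nat \<Rightarrow> list_partition" where
  "blocks \<kappa> 0 = ([], [])"
| "blocks \<kappa> (Suc n) =
     (case blocks \<kappa> n of (C, Fs) \<Rightarrow>
        if Suc (length C) < \<kappa> then (n # C, Fs) else ([], (n # C) # Fs))"

fun T_blocks :: "nat \<Rightarrow> nat \<Rightarrow> nat" where
  "T_blocks \<kappa> 0 = 1"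
| "T_blocks \<kappa> (Suc n) =
     T_blocks \<kappa> n + (case blocks \<kappa> n of (C, Fs) \<Rightarrow> T_length C) + 1"

definition find_stable :: "nat list list \<Rightarrow> nat \<Rightarrow> list_partition" where
  "find_stable M \<kappa> = (case blocks \<kappa> (length M) of (C, Fs) \<Rightarrow> run_phases M \<kappa> C Fs)"

definition T_find_stable :: "nat list list \<Rightarrow> nat \<Rightarrow> nat option" where
  "T_find_stable M \<kappa> =
     (case blocks \<kappa> (length M) of (C, Fs) \<Rightarrow>
        Option.bind (T_run_phases M \<kappa> C Fs)
          (\<lambda>t. Some (T_length M + T_blocks \<kappa> (length M) + t)))"

end

theory Submission
  imports Defs
begin

text \<open>
  As long as all coalitions but one are full, a better response moves an agent i from a full
  coalition D to the other one, C, with U(C + i) > U(D). The imitations then fill C up and leave a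
  coalition of the original size of C behind, so that the full coalition D has been replaced by a
  full coalition whose utility is larger by at least 1, at the cost of at most max_size moves. The
  total utility of the full coalitions is at most \<beta> |S| times their number, which is at most
  |N| / max_size, and hence there are at most \<beta> |N| |S| moves.
\<close>

section \<open>Joint utilities\<close>

text \<open>Better responses can only aim at \<open>C\<close>, because every other coalition is
  full, and agents of \<open>C\<close> have none, since rejoining their own coalition changes
  nothing. If \<open>C\<close> has c agents and full coalitions have k, filling \<open>C\<close>
  takes k - c agents out of the k in \<open>D\<close> and leaves c behind, which is why the shape
  recurs. The obstacle is that the agents left behind may be worth far less than \<open>C\<close>
  was, so the utility summed over all coalitions can fall. Only full coalitions therefore carry
  credit. During a phase two coalitions may fail to be full while moves are already being made, so
  the bound needs a second form of the invariant that charges moves one at a time; this also bounds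
  runs that are cut off inside a phase. The algorithm works on lists and performs whole phases. Its
  part of the proof replays each phase as steps of the dynamics and bounds the number of phases by
  the same potential, now over natural numbers.\<close>

lemma finite_agents: "is_zero_beta_heg \<beta> G \<Longrightarrow> finite (agents G)"
  by (simp add: is_zero_beta_heg_def is_heg_def)

text \<open>The maximum over a finite nonempty set is attained, so it inherits the range of the
  expertise values. Integrality, sign and upper bound of the joint utility all follow from
  this.\<close>

lemma joint_expertise_mem:
  assumes "is_zero_beta_heg \<beta> G" "C \<subseteq> agents G" "C \<noteq> {}" "s \<in> skills G"
  shows "joint_expertise G C s \<in> real ` {0..\<beta>}"
proof -
  have "finite C"
    using assms finite_agents finite_subset by blast
  then have "joint_expertise G C s \<in> (\<lambda>i. expertise G i s) ` C"
    unfolding joint_expertise_def using assms(3) by (intro Max_in) auto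
  then obtain i where "i \<in> C" "joint_expertise G C s = expertise G i s"
    by blast
  moreover have "\<forall>i\<in>agents G. \<forall>s\<in>skills G. expertise G i s \<in> real ` {0..\<beta>}"
    using assms(1) by (simp add: is_zero_beta_heg_def)
  ultimately show ?thesis
    using assms(2,4) by (metis subsetD)
qed

lemma joint_utility_Ints:
  assumes "is_zero_beta_heg \<beta> G" "C \<subseteq> agents G"
  shows "joint_utility G C \<in> \<int>"
  using joint_expertise_mem[OF assms] by (fastforce simp: joint_utility_def intro!: Ints_sum)

lemma joint_utility_nonneg:
  assumes "is_zero_beta_heg \<beta> G" "C \<subseteq> agents G"
  shows "0 \<le> joint_utility G C"
  using joint_expertise_mem[OF assms] by (fastforce simp: joint_utility_def intro!: sum_nonneg)

lemma joint_utility_le: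
  assumes "is_zero_beta_heg \<beta> G" "C \<subseteq> agents G"
  shows "joint_utility G C \<le> real (\<beta> * card (skills G))"
proof (cases "C = {}")
  case False
  then have "joint_expertise G C s \<le> real \<beta>" if "s \<in> skills G" for s
    using joint_expertise_mem[OF assms False that] by auto
  then show ?thesis
    using False sum_bounded_above[of "skills G" "joint_expertise G C" "real \<beta>"]
    by (simp add: joint_utility_def mult.commute)
qed (simp add: joint_utility_def)

lemma joint_utility_mono:
  assumes G: "is_zero_beta_heg \<beta> G" and "C \<subseteq> C'" "C' \<subseteq> agents G"
  shows "joint_utility G C \<le> joint_utility G C'"
\<comment> \<open>\<open>Max {}\<close> is unspecified, so the empty set is settled by the
  convention that its utility is 0.\<close>
proof (cases "C = {}")
  case True
  then show ?thesis
    using joint_utility_nonneg[OF G assms(3)] by (simp add: joint_utility_def)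
next
  case False
  have "finite C'"
    using assms finite_agents finite_subset by blast
  then have "joint_expertise G C s \<le> joint_expertise G C' s" for s
    unfolding joint_expertise_def using assms(2) False by (intro Max_mono) auto
  then show ?thesis
    using False assms(2) by (auto simp: joint_utility_def intro!: sum_mono)
qed

lemma Ints_less_imp_add1_le:
  fixes x y :: real
  assumes "x \<in> \<int>" "y \<in> \<int>" "x < y"
  shows "x + 1 \<le> y"
  using assms by (auto elim!: Ints_cases)


section \<open>Relocations\<close>

text \<open>A move affects two coalitions only: the target \<open>T\<close> and the coalition
  \<open>R\<close> that is being left. Their union does not change, so the partition
  \<open>P\<close> of all other agents stays fixed throughout a phase.\<close>

definition splits :: "'a set \<Rightarrow> 'a set \<Rightarrow> 'a set \<Rightarrow> 'a set set \<Rightarrow> bool" where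
  "splits A T R P \<longleftrightarrow>
     T \<noteq> {} \<and> R \<noteq> {} \<and> T \<inter> R = {} \<and> T \<union> R \<subseteq> A \<and> partition_on (A - (T \<union> R)) P"

lemma splits_partition_on:
  assumes "splits A T R P"
  shows "partition_on A (insert T (insert R P))"
proof -
  have P: "\<Union>P = A - (T \<union> R)" "disjoint P" "{} \<notin> P"
    using assms by (auto simp: splits_def partition_on_def)
  then have "disjnt R (\<Union>P)" "disjnt T (\<Union>(insert R P))"
    using assms by (auto simp: splits_def disjnt_def)
  moreover have "A - T - R = A - (T \<union> R)"
    by auto
  ultimately show ?thesis
    using assms by (auto simp: splits_def partition_on_insert)
qed

lemma splits_notin: "splits A T R P \<Longrightarrow> T \<notin> P \<and> R \<notin> P \<and> T \<noteq> R"
  unfolding splits_def partition_on_def by blast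

lemma splitsI:
  assumes part: "partition_on A \<pi>" and "T \<in> \<pi>" "R \<in> \<pi>" "T \<noteq> R"
  shows "splits A T R (\<pi> - {T, R})"
proof -
  have disj: "X \<inter> Y = {}" if "X \<in> \<pi>" "Y \<in> \<pi>" "X \<noteq> Y" for X Y
    using part that by (auto simp: partition_on_def disjoint_def)
  have "X \<subseteq> A - (T \<union> R)" if "X \<in> \<pi> - {T, R}" for X
    using that disj[of X T] disj[of X R] assms partition_onD1[OF part] by blast
  then have "\<Union>(\<pi> - {T, R}) = A - (T \<union> R)"
    using partition_onD1[OF part] by blast
  then have "partition_on (A - (T \<union> R)) (\<pi> - {T, R})"
    using part by (auto simp: partition_on_def disjoint_def)
  then show ?thesis
    using assms disj[of T R] by (auto simp: splits_def partition_on_def)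
qed

lemma coalition_of_eq:
  assumes "partition_on A \<pi>" "X \<in> \<pi>" "i \<in> X"
  shows "coalition_of \<pi> i = X"
  unfolding coalition_of_def
  using assms by (intro the_equality) (auto simp: partition_on_def disjoint_def)

lemma splits_move:
  assumes "splits A T R P" "i \<in> R" "R \<noteq> {i}"
  shows "splits A (insert i T) (R - {i}) P"
proof -
  have "insert i T \<union> (R - {i}) = T \<union> R"
    using assms by auto
  then show ?thesis
    using assms by (auto simp: splits_def)
qed

text \<open>With \<open>R \<noteq> {i}\<close> no empty coalition has to be discarded, and as
  \<open>T\<close> and \<open>R\<close> are not in \<open>P\<close>, removing them leaves exactly
  \<open>P\<close>.\<close>

lemma relocate_splits:
  assumes "splits A T R P" "i \<in> R" "R \<noteq> {i}"
  shows "relocate (insert T (insert R P)) i T = insert (insert i T) (insert (R - {i}) P)"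
proof -
  have "coalition_of (insert T (insert R P)) i = R"
    using coalition_of_eq[OF splits_partition_on[OF assms(1)]] assms(2) by simp
  moreover have "R - {i} \<noteq> {}"
    using assms by auto
  ultimately show ?thesis
    using splits_notin[OF assms(1)] by (auto simp: relocate_def)
qed


section \<open>The number of moves\<close>

text \<open>
  The inequality says t \<le> k (U(P) + U(T) - 1) + |T| for k = max_size G, without subtraction: the
  growing target T is credited k (U(T) - 1) + |T| moves, which becomes k U(T) once T is full.
\<close>

definition mid_phase :: "('a, 's) heg \<Rightarrow> nat \<Rightarrow> 'a set set \<Rightarrow> 'a set \<Rightarrow> 'a set \<Rightarrow> 'a set set \<Rightarrow> bool" where
  "mid_phase G t \<pi> T R P \<longleftrightarrow>
     \<pi> = insert T (insert R P) \<and> splits (agents G) T R P \<and> (\<forall>X\<in>P. card X = max_size G) \<and>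
     card T \<le> max_size G \<and> card R < max_size G \<and> max_size G < card T + card R \<and>
     real t + real (max_size G) \<le>
       real (max_size G) * (sum (joint_utility G) P + joint_utility G T) + real (card T)"

definition phase_end :: "('a, 's) heg \<Rightarrow> nat \<Rightarrow> 'a set set \<Rightarrow> bool" where
  "phase_end G t \<pi> \<longleftrightarrow> is_solution G \<pi> \<and> almost_full G \<pi> \<and>
     real t \<le> real (max_size G) * sum (joint_utility G) {X \<in> \<pi>. card X = max_size G}"

text \<open>The recorded move \<open>(j, D, C)\<close> already names the two coalitions that it
  changed, so only \<open>P\<close> is quantified. The second clause also covers a phase that has
  just ended, with \<open>insert j C\<close> full.\<close>

fun dyn_inv :: "('a, 's) heg \<Rightarrow> nat \<Rightarrow> 'a state \<Rightarrow> bool" where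
  "dyn_inv G t (\<pi>, None) \<longleftrightarrow> phase_end G t \<pi>"
| "dyn_inv G t (\<pi>, Some (j, D, C)) \<longleftrightarrow> (\<exists>P. mid_phase G t \<pi> (insert j C) (D - {j}) P)"

lemma is_solution_mid_phase:
  assumes "is_zero_beta_heg \<beta> G" "mid_phase G t \<pi> T R P"
  shows "is_solution G \<pi>"
proof -
  have "partition_on (agents G) \<pi>"
    using assms splits_partition_on by (auto simp: mid_phase_def)
  moreover from this have "X \<subseteq> agents G \<and> X \<noteq> {}" if "X \<in> \<pi>" for X
    using that by (auto simp: partition_on_def)
  ultimately show ?thesis
    using assms(2) by (auto simp: is_solution_def is_coalition_def mid_phase_def)
qed

lemma phase_end_mid_phase:
  assumes G: "is_zero_beta_heg \<beta> G" and mid: "mid_phase G t \<pi> T R P" and "card T = max_size G"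
  shows "phase_end G t \<pi>"
proof -
  have "almost_full G \<pi>"
    using assms unfolding almost_full_def by (intro exI[of _ R]) (auto simp: mid_phase_def)
  moreover have "{X \<in> \<pi>. card X = max_size G} = insert T P"
    using assms by (auto simp: mid_phase_def)
  moreover have "finite P"
    using mid finite_agents[OF G] finite_elements[of "agents G - (T \<union> R)" P]
    by (auto simp: mid_phase_def splits_def)
  moreover have "T \<notin> P"
    using mid splits_notin by (auto simp: mid_phase_def)
  ultimately show ?thesis
    using assms is_solution_mid_phase[OF G mid]
    by (simp add: phase_end_def mid_phase_def algebra_simps)
qed

text \<open>The move is paid for by the growth of \<open>card T\<close>, while the utility of
  \<open>T\<close> does not fall by monotonicity. As \<open>T\<close> is not full and
  \<open>T\<close> and \<open>R\<close> together exceed \<open>max_size G\<close>, \<open>R\<close>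
  has at least two agents and does not become empty.\<close>

lemma mid_phase_imitation:
  assumes G: "is_zero_beta_heg \<beta> G" and mid: "mid_phase G t \<pi> T R P"
    and "card T < max_size G" "i \<in> R"
  shows "coalition_of \<pi> i = R" "mid_phase G (Suc t) (relocate \<pi> i T) (insert i T) (R - {i}) P"
proof -
  have sp: "splits (agents G) T R P"
    using mid by (simp add: mid_phase_def)
  show "coalition_of \<pi> i = R"
    using coalition_of_eq[OF splits_partition_on[OF sp]] assms by (simp add: mid_phase_def)
  have "R \<noteq> {i}"
    using assms by (auto simp: mid_phase_def)
  note sp' = splits_move[OF sp \<open>i \<in> R\<close> this] and rel = relocate_splits[OF sp \<open>i \<in> R\<close> this]
  have fin: "finite T" "finite R"
    using sp finite_agents[OF G] by (auto simp: splits_def dest: finite_subset)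
  have "i \<notin> T"
    using sp \<open>i \<in> R\<close> by (auto simp: splits_def)
  then have card: "card (insert i T) = Suc (card T)" "card (R - {i}) = card R - 1" "card R > 0"
    using fin \<open>i \<in> R\<close> by (auto simp: card_gt_0_iff)
  moreover have "real (max_size G) * joint_utility G T
      \<le> real (max_size G) * joint_utility G (insert i T)"
    using sp' by (intro mult_left_mono joint_utility_mono[OF G]) (auto simp: splits_def)
  ultimately have "real (Suc t) + real (max_size G)
      \<le> real (max_size G) * (sum (joint_utility G) P + joint_utility G (insert i T))
        + real (card (insert i T))"
    using mid unfolding mid_phase_def distrib_left by linarith
  then show "mid_phase G (Suc t) (relocate \<pi> i T) (insert i T) (R - {i}) P"
    using assms sp' rel card unfolding mid_phase_def by auto
qed

text \<open>The target is not full, so it is the one exception that \<open>almost_full\<close>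
  permits. The source differs from it, since joining one's own coalition yields no gain, and hence
  is full.\<close>

lemma free_move_splits:
  assumes sol: "is_solution G \<pi>" and af: "almost_full G \<pi>" and br: "better_response G \<pi> i C"
  obtains D where "coalition_of \<pi> i = D" "i \<in> D" "D \<in> \<pi>" "D \<noteq> C" "card D = max_size G"
    "splits (agents G) C D (\<pi> - {C, D})" "\<forall>X\<in>\<pi> - {C, D}. card X = max_size G"
proof -
  have part: "partition_on (agents G) \<pi>"
    using sol by (simp add: is_solution_def)
  then obtain D where D: "D \<in> \<pi>" "i \<in> D"
    using br by (auto simp: better_response_def partition_on_def)
  have co: "coalition_of \<pi> i = D"
    using coalition_of_eq[OF part D] .
  have ne: "D \<noteq> C"
    using br D by (auto simp: better_response_def co insert_absorb)
  have "card X = max_size G" if "X \<in> \<pi>" "X \<noteq> C" for X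
    using af br that by (metis almost_full_def better_response_def less_irrefl)
  then show ?thesis
    using that[OF co D(2,1) ne] D ne splitsI[OF part _ D(1)] br by (auto simp: better_response_def)
qed

lemma mid_phase_free:
  assumes G: "is_zero_beta_heg \<beta> G" and pe: "phase_end G t \<pi>" and br: "better_response G \<pi> i C"
  shows "\<exists>P. mid_phase G (Suc t) (relocate \<pi> i C) (insert i C) (coalition_of \<pi> i - {i}) P"
proof -
  have sol: "is_solution G \<pi>" and af: "almost_full G \<pi>"
    using pe by (auto simp: phase_end_def)
  obtain D where co: "coalition_of \<pi> i = D"
    and D: "i \<in> D" "D \<in> \<pi>" "D \<noteq> C" "card D = max_size G"
    and sp: "splits (agents G) C D (\<pi> - {C, D})" and full: "\<forall>X\<in>\<pi> - {C, D}. card X = max_size G"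
    by (rule free_move_splits[OF sol af br]) (rule that)
  define P where "P = \<pi> - {C, D}"
  have C: "C \<in> \<pi>" "card C < max_size G" "joint_utility G D < joint_utility G (insert i C)"
    using br by (auto simp: better_response_def co)
  have \<pi>: "\<pi> = insert C (insert D P)"
    using C D by (auto simp: P_def)
  have fin: "finite C" "finite D" "finite \<pi>"
    using sp finite_agents[OF G] finite_elements[of "agents G" \<pi>] pe
    by (auto simp: splits_def phase_end_def is_solution_def dest: finite_subset)
  have pos: "0 < card C"
    using sp fin by (auto simp: splits_def card_gt_0_iff)
  have "i \<notin> C"
    using sp D by (auto simp: splits_def)
  have "D \<noteq> {i}"
    using pos C D by auto
  note sp' = splits_move[OF sp D(1) this] and rel = relocate_splits[OF sp D(1) this]
  have "{X \<in> \<pi>. card X = max_size G} = insert D P"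
    using full C D by (auto simp: P_def)
  then have "real t \<le> real (max_size G) * (sum (joint_utility G) P + joint_utility G D)"
    using pe fin by (simp add: phase_end_def P_def add.commute)
  \<comment> \<open>Utilities are integers, so the strict gain is at least 1. Multiplied by
    \<open>max_size G\<close>, it provides the credit for the whole phase; the present move is
    covered by \<open>card (insert i C)\<close>, which is positive.\<close>
  also have "\<dots> \<le> real (max_size G) * (sum (joint_utility G) P + joint_utility G (insert i C) - 1)"
    using Ints_less_imp_add1_le[OF joint_utility_Ints[OF G] joint_utility_Ints[OF G] C(3)] sp' sp
    by (intro mult_left_mono) (auto simp: splits_def)
  finally have "real t + real (max_size G)
      \<le> real (max_size G) * (sum (joint_utility G) P + joint_utility G (insert i C))"
    by (simp add: algebra_simps)
  moreover have "card (D - {i}) = max_size G - 1" "card (insert i C) = Suc (card C)"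
    using fin D \<open>i \<notin> C\<close> by auto
  ultimately have "mid_phase G (Suc t) (relocate \<pi> i C) (insert i C) (D - {i}) P"
    using sp' rel full C pos \<pi> unfolding mid_phase_def P_def by auto
  then show ?thesis
    using co by blast
qed

text \<open>If the last move forces no imitation, its target has at least the maximal size, hence
  exactly this size by \<open>mid_phase\<close>, and the phase is complete.\<close>

lemma phase_end_dyn_inv:
  assumes "is_zero_beta_heg \<beta> G" "dyn_inv G t (\<pi>, l)" "\<not> must_imitate G l"
  shows "phase_end G t \<pi>"
proof (cases l)
  case (Some a)
  then obtain j D C P where "l = Some (j, D, C)" "mid_phase G t \<pi> (insert j C) (D - {j}) P"
    using assms(2) by (cases a) auto
  then show ?thesis
    using assms phase_end_mid_phase[of \<beta> G t \<pi> "insert j C"] by (force simp: mid_phase_def)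
qed (use assms in simp)

lemma dyn_inv_step:
  assumes G: "is_zero_beta_heg \<beta> G" and "imitative_step G s s'" "dyn_inv G t s"
  shows "dyn_inv G (Suc t) s'"
  using assms(2,3)
proof cases
  case (free \<pi> last_move i C)
  then show ?thesis
    using mid_phase_free[OF G phase_end_dyn_inv[OF G]] assms(3) by auto
next
  case (imitation \<pi> j D C i)
  then obtain P where P: "mid_phase G t \<pi> (insert j C) (D - {j}) P"
    using assms(3) by auto
  show ?thesis
    using mid_phase_imitation[OF G P, of i] imitation by auto
qed

lemma dyn_inv_reaches:
  assumes G: "is_zero_beta_heg \<beta> G" and "is_solution G \<pi>\<^sub>0" "almost_full G \<pi>\<^sub>0"
    and "(imitative_step G ^^ t) (\<pi>\<^sub>0, None) s"
  shows "dyn_inv G t s"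
  using assms(4)
proof (induction t arbitrary: s)
  case 0
  have "0 \<le> sum (joint_utility G) {X \<in> \<pi>\<^sub>0. card X = max_size G}"
    using assms(2) by (intro sum_nonneg joint_utility_nonneg[OF G])
      (auto simp: is_solution_def is_coalition_def)
  then show ?case
    using assms 0 by (auto simp: phase_end_def)
next
  case (Suc t)
  then show ?case
    using dyn_inv_step[OF G] by (elim relpowp_Suc_E) blast
qed

section \<open>Bounding the potential and the runs that get stuck\<close>

lemma sum_utility_le:
  assumes G: "is_zero_beta_heg \<beta> G" and "\<forall>X\<in>P. X \<subseteq> agents G"
  shows "sum (joint_utility G) P \<le> real (card P) * real (\<beta> * card (skills G))"
  using assms by (intro sum_bounded_above joint_utility_le[OF G]) auto

lemma card_full_coalitions:
  assumes "finite A" "partition_on A P" "\<forall>X\<in>P. card X = k"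
  shows "k * card P = card A"
proof -
  have "finite X" if "X \<in> P" for X
    using that assms(1) partition_onD1[OF assms(2)] by (metis Sup_upper finite_subset)
  then show ?thesis
    using product_partition[OF assms(2)] assms(3) by simp
qed

lemma phase_end_moves_le:
  assumes G: "is_zero_beta_heg \<beta> G" and "phase_end G t \<pi>"
  shows "t \<le> \<beta> * (card (agents G) * card (skills G))"
proof -
  define P where "P = {X \<in> \<pi>. card X = max_size G}"
  have part: "partition_on (agents G) \<pi>"
    using assms by (simp add: phase_end_def is_solution_def)
  have P: "partition_on (\<Union>P) P" "\<Union>P \<subseteq> agents G" "\<forall>X\<in>P. X \<subseteq> agents G"
    using part by (auto simp: partition_on_def P_def disjoint_def)
  have "max_size G * card P \<le> card (agents G)"
    using card_full_coalitions[OF finite_subset[OF P(2) finite_agents[OF G]] P(1)]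
      card_mono[OF finite_agents[OF G] P(2)] by (simp add: P_def)
  then have le: "real (max_size G * card P) \<le> real (card (agents G))"
    by linarith
  have "real t \<le> real (max_size G) * sum (joint_utility G) P"
    using assms by (simp add: phase_end_def P_def)
  also have "\<dots> \<le> real (max_size G) * (real (card P) * real (\<beta> * card (skills G)))"
    by (intro mult_left_mono sum_utility_le[OF G P(3)]) simp
  also have "\<dots> = real (max_size G * card P) * real (\<beta> * card (skills G))"
    by simp
  also have "\<dots> \<le> real (card (agents G)) * real (\<beta> * card (skills G))"
    by (intro mult_right_mono le) simp
  also have "\<dots> = real (\<beta> * (card (agents G) * card (skills G)))"
    by simp
  finally show ?thesis
    by linarith
qed

text \<open>The utility of \<open>T\<close> is counted even before \<open>T\<close> is full. This is
  affordable because \<open>T\<close> and \<open>R\<close> together hold more than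
  \<open>max_size G\<close> agents, which leaves room for one more full coalition beside those in
  \<open>P\<close>.\<close>

lemma mid_phase_moves_le:
  assumes G: "is_zero_beta_heg \<beta> G" and mid: "mid_phase G t \<pi> T R P"
  shows "t \<le> \<beta> * (card (agents G) * card (skills G))"
proof -
  have sp: "splits (agents G) T R P"
    using mid by (simp add: mid_phase_def)
  have fin: "finite T" "finite R"
    using sp finite_agents[OF G] by (auto simp: splits_def dest: finite_subset)
  have "max_size G * card P = card (agents G - (T \<union> R))"
    using card_full_coalitions[of "agents G - (T \<union> R)" P] finite_agents[OF G] mid sp
    by (auto simp: mid_phase_def splits_def)
  also have "\<dots> + (card T + card R) = card (agents G)"
    using sp fin finite_agents[OF G] card_mono[OF finite_agents[OF G], of "T \<union> R"]
    by (auto simp: splits_def card_Diff_subset card_Un_disjoint)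
  finally have "max_size G * Suc (card P) \<le> card (agents G)"
    using mid by (auto simp: mid_phase_def)
  then have le: "real (max_size G * Suc (card P)) \<le> real (card (agents G))"
    by linarith
  have sub: "\<forall>X\<in>P. X \<subseteq> agents G" "T \<subseteq> agents G"
    using sp by (auto simp: splits_def partition_on_def)
  have "real t \<le> real (max_size G) * (sum (joint_utility G) P + joint_utility G T)"
    using mid by (simp add: mid_phase_def)
  also have "\<dots> \<le> real (max_size G) * (real (card P) * real (\<beta> * card (skills G))
      + real (\<beta> * card (skills G)))"
    by (intro mult_left_mono add_mono sum_utility_le[OF G sub(1)] joint_utility_le[OF G sub(2)]) simp
  also have "\<dots> = real (max_size G * Suc (card P)) * real (\<beta> * card (skills G))"
    by (simp add: algebra_simps)
  also have "\<dots> \<le> real (card (agents G)) * real (\<beta> * card (skills G))"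
    by (intro mult_right_mono le) simp
  also have "\<dots> = real (\<beta> * (card (agents G) * card (skills G)))"
    by simp
  finally show ?thesis
    by linarith
qed

lemma dyn_inv_moves_le:
  assumes "is_zero_beta_heg \<beta> G" "dyn_inv G t s"
  shows "t \<le> \<beta> * (card (agents G) * card (skills G))"
  using assms by (cases "(G, t, s)" rule: dyn_inv.cases)
    (auto dest: phase_end_moves_le mid_phase_moves_le)

lemma is_solution_dyn_inv:
  assumes "is_zero_beta_heg \<beta> G" "dyn_inv G t (\<pi>, l)"
  shows "is_solution G \<pi>"
  using assms is_solution_mid_phase
  by (cases "(G, t, (\<pi>, l))" rule: dyn_inv.cases) (auto simp: phase_end_def)

text \<open>The dynamics never blocks at an unstable partition: a forced imitation finds an agent
  because \<open>splits\<close> keeps the source nonempty, and otherwise instability is itself a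
  better response. With the bound on moves, every maximal run ends in a Nash stable
  partition.\<close>

lemma nash_stable_if_stuck:
  assumes "dyn_inv G t (\<pi>, l)" "\<nexists>st. imitative_step G (\<pi>, l) st"
  shows "nash_stable G \<pi>"
proof (rule ccontr)
  assume unstable: "\<not> nash_stable G \<pi>"
  show False
  proof (cases "must_imitate G l")
    case False
    obtain i C where "better_response G \<pi> i C"
      using unstable by (auto simp: nash_stable_def better_response_def not_le)
    then show False
      using imitative_step.free[OF unstable False] assms(2) by blast
  next
    case True
    then obtain j D C where l: "l = Some (j, D, C)"
      by (cases "(G, l)" rule: must_imitate.cases) auto
    then have "D - {j} \<noteq> {}"
      using assms(1) unfolding l dyn_inv.simps mid_phase_def splits_def by blast
    then obtain i where "i \<in> D - {j}"
      by blast
    then show False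
      using imitative_step.imitation[OF unstable] True assms(2) l by blast
  qed
qed


section \<open>Correctness of the algorithm\<close>

lemma delete_eq_remove1: "delete i D = remove1 i D"
  by (induction D) auto

lemma total_eq_sum_list: "total xs = sum_list xs"
  by (induction xs) auto

lemma vec_max_eq_map2: "length xs = length ys \<Longrightarrow> vec_max xs ys = map2 max xs ys"
  by (induction xs ys rule: list_induct2) auto

lemma vec_max_Nil2: "vec_max xs [] = xs"
  by (cases xs) auto

text \<open>The closed form makes sizes and contents of both results readable. The reversal arises
  because agents are prepended to \<open>C\<close> one by one.\<close>

lemma imitate_eq:
  "imitate k C D = (drop (k - length C) D, rev (take (k - length C) D) @ C)"
proof (induction D arbitrary: C)
  case (Cons i D)
  show ?case
  proof (cases "length C < k")
    case True
    then have "k - length C = Suc (k - Suc (length C))"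
      by simp
    then show ?thesis
      using True Cons by simp
  qed simp
qed simp

lemma find_agent_SomeD:
  "find_agent M C u D = Some i \<Longrightarrow> i \<in> set D \<and> u < utility M (i # C)"
  by (induction D) (auto split: if_splits)

lemma find_agent_NoneD:
  "find_agent M C u D = None \<Longrightarrow> \<forall>i\<in>set D. utility M (i # C) \<le> u"
  by (induction D) (auto split: if_splits)

lemma phase_NoneD:
  "phase M k C Fs = None \<Longrightarrow> \<forall>D\<in>set Fs. \<forall>i\<in>set D. utility M (i # C) \<le> utility M D"
  by (induction Fs)
    (auto simp del: utility.simps split: option.splits prod.splits dest: find_agent_NoneD)

lemma phase_SomeE:
  assumes "phase M k C Fs = Some (C', Fs')"
  obtains Fs1 D Fs2 i T where "Fs = Fs1 @ D # Fs2" "Fs' = Fs1 @ T # Fs2" "i \<in> set D"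
    "utility M D < utility M (i # C)" "imitate k (i # C) (remove1 i D) = (C', T)"
  using assms
proof (induction Fs arbitrary: Fs' thesis)
  case (Cons D Fs)
  show ?case
  proof (cases "find_agent M C (utility M D) D")
    case None
    then obtain Gs where "phase M k C Fs = Some (C', Gs)" "Fs' = D # Gs"
      using Cons.prems(2) by (auto simp del: utility.simps split: option.splits)
    with Cons.IH[of Gs] Cons.prems(1)[of "D # _"] show ?thesis
      by (metis append_Cons)
  next
    case (Some i)
    then show ?thesis
      using Cons.prems(1)[of "[]" D Fs _ i] Cons.prems(2) find_agent_SomeD[OF Some]
      by (auto simp del: utility.simps imitate.simps simp: delete_eq_remove1 split: prod.splits)
  qed
qed simp

lemma partition_on_concat:
  assumes "distinct (concat xss)" "[] \<notin> set xss"
  shows "partition_on (set (concat xss)) (set ` set xss)"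
  using assms
proof (induction xss)
  case (Cons xs xss)
  have "disjnt (set xs) (\<Union>(set ` set xss))" "set xs \<union> set (concat xss) - set xs = set (concat xss)"
    using Cons.prems by (auto simp: disjnt_def)
  then show ?case
    using Cons by (auto simp add: partition_on_insert)
qed (simp add: partition_on_empty)

lemma not_nash_stable_if_better_response:
  "better_response G \<pi> i C \<Longrightarrow> \<not> nash_stable G \<pi>"
  by (auto simp: better_response_def nash_stable_def not_le)

text \<open>The rule for imitations demands that the partition be unstable, not that the moving
  agent gain. Instability is witnessed by the imitation itself: \<open>C\<close> only grows and
  \<open>D\<close> only shrinks, so the utility inequality persists and each agent of
  \<open>D\<close> gains by joining \<open>C\<close>. The equations for \<open>C\<close> and
  \<open>D0\<close> tie the lists to the recorded move; an empty \<open>D\<close> contradicts the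
  two length bounds.\<close>

lemma imitate_reaches:
  assumes G: "is_zero_beta_heg \<beta> G"
    and "splits (agents G) (set C) (set D) P" "distinct C" "distinct D"
    and "length C \<le> max_size G" "max_size G < length C + length D"
    and "joint_utility G (set D) < joint_utility G (set C)"
    and "imitate (max_size G) C D = (D', C')" "C = j # C0"
    and "D0 - {j} = set D"
  shows "\<exists>l. (imitative_step G)\<^sup>*\<^sup>* (insert (set C) (insert (set D) P), Some (j, D0, set C0))
      (insert (set C') (insert (set D') P), l) \<and> \<not> must_imitate G l"
  using assms(2-)
proof (induction D arbitrary: C j C0 D0)
  case (Cons i D)
  let ?\<pi> = "insert (set C) (insert (set (i # D)) P)"
  have card: "card (set C0 \<union> {j}) = length C" "set C0 \<union> {j} = set C"
    using Cons.prems distinct_card[of C] by auto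
  show ?case
  proof (cases "length C < max_size G")
    case True
    have i: "i \<in> set (i # D)" "i \<notin> set C" "set (i # D) - {i} = set D"
      using Cons.prems by (auto simp: splits_def)
    have "D \<noteq> []"
      using True Cons.prems(5) by auto
    then have "set (i # D) \<noteq> {i}"
      using i(3) by (metis Diff_cancel set_empty)
    note sp = splits_move[OF Cons.prems(1) i(1) this, unfolded i(3)]
      and rel = relocate_splits[OF Cons.prems(1) i(1) this, unfolded i(3)]
    have co: "coalition_of ?\<pi> i = set (i # D)"
      using coalition_of_eq[OF splits_partition_on[OF Cons.prems(1)]] by simp
    have agents: "set (i # C) \<subseteq> agents G" "set (i # D) \<subseteq> agents G"
      using Cons.prems(1) by (auto simp: splits_def)
    have U: "joint_utility G (set C) \<le> joint_utility G (set (i # C))"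
      "joint_utility G (set D) \<le> joint_utility G (set (i # D))"
      using agents by (auto intro!: joint_utility_mono[OF G])
    have "joint_utility G (set (i # D)) < joint_utility G (set C \<union> {i})"
      using U Cons.prems(6) by simp
    then have "better_response G ?\<pi> i (set C)"
      using agents True distinct_card[OF Cons.prems(2)] by (simp add: better_response_def co[simplified])
    then have "\<not> nash_stable G ?\<pi>"
      by (rule not_nash_stable_if_better_response)
    then have "imitative_step G (?\<pi>, Some (j, D0, set C0))
        (relocate ?\<pi> i (set C0 \<union> {j}), Some (i, coalition_of ?\<pi> i, set C0 \<union> {j}))"
    proof (rule imitation)
      show "must_imitate G (Some (j, D0, set C0))"
        using True by (simp only: must_imitate.simps card(1))
      show "i \<in> D0 - {j}"
        unfolding Cons.prems(9) by simp
    qed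
    then have step: "imitative_step G (?\<pi>, Some (j, D0, set C0))
        (insert (set (i # C)) (insert (set D) P), Some (i, set (i # D), set C))"
      unfolding card(2) co rel by simp
    have "\<exists>l. (imitative_step G)\<^sup>*\<^sup>*
        (insert (set (i # C)) (insert (set D) P), Some (i, set (i # D), set C))
        (insert (set C') (insert (set D') P), l) \<and> \<not> must_imitate G l"
    proof (rule Cons.IH[OF _ _ _ _ _ _ _ refl i(3)])
      show "splits (agents G) (set (i # C)) (set D) P"
        using sp by simp
      show "joint_utility G (set D) < joint_utility G (set (i # C))"
        using U Cons.prems(6) by linarith
      show "imitate (max_size G) (i # C) D = (D', C')"
        using True Cons.prems(7) by simp
    qed (use True Cons.prems(2,3,5) i(2) in auto)
    then show ?thesis
      using step by (meson converse_rtranclp_into_rtranclp)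
  next
    case False
    then have "\<not> must_imitate G (Some (j, D0, set C0))" "D' = i # D" "C' = C"
      using Cons.prems(7) card(1) by (simp_all only: must_imitate.simps) simp_all
    then show ?thesis
      by blast
  qed
qed simp

section \<open>Matrix instances and their list partitions\<close>

locale matrix_instance =
  fixes \<beta> :: nat and M :: "nat list list" and m \<kappa> :: nat
  assumes inst: "is_matrix_instance \<beta> M m \<kappa>"
begin

abbreviation G :: "(nat, nat) heg" where
  "G \<equiv> matrix_heg M m \<kappa>"

lemma matrix_heg_sel [simp]:
  "agents G = {..<length M}" "skills G = {..<m}" "max_size G = \<kappa>"
  "expertise G i s = real (M ! i ! s)"
  by (simp_all add: matrix_heg_def)

lemma size_bound_pos: "0 < \<kappa>"
  using inst by (simp add: is_matrix_instance_def)

lemma length_row: "i < length M \<Longrightarrow> length (M ! i) = m"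
  using inst by (simp add: is_matrix_instance_def)

lemma zero_beta: "is_zero_beta_heg \<beta> G"
proof -
  have "M ! i ! s \<in> {0..\<beta>}" if "i < length M" "s < m" for i s
    using inst length_row[OF that(1)] that unfolding is_matrix_instance_def
    by (metis nth_mem subsetD)
  then show ?thesis
    using size_bound_pos by (auto simp: is_zero_beta_heg_def is_heg_def)
qed

text \<open>The empty list is excluded, as its row is \<open>[]\<close> and does not have length
  \<open>m\<close>. Since \<open>vec_max\<close> treats \<open>[]\<close> as neutral, the induction
  effectively starts at one agent.\<close>

lemma joint_row_props:
  assumes "set C \<subseteq> {..<length M}" "C \<noteq> []"
  shows "length (joint_row M C) = m \<and>
    (\<forall>s<m. joint_row M C ! s = Max ((\<lambda>i. M ! i ! s) ` set C))"
  using assms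
proof (induction C)
  case (Cons i C)
  then have len: "length (M ! i) = m"
    using length_row by simp
  show ?case
  proof (cases "C = []")
    case True
    then show ?thesis
      using len by (simp add: vec_max_Nil2)
  next
    case False
    then have "length (joint_row M C) = m"
      "\<forall>s<m. joint_row M C ! s = Max ((\<lambda>i. M ! i ! s) ` set C)"
      using Cons by auto
    then show ?thesis
      using len False by (simp add: vec_max_eq_map2)
  qed
qed simp

lemma joint_utility_eq:
  assumes "set C \<subseteq> {..<length M}"
  shows "joint_utility G (set C) = real (utility M C)"
proof (cases "C = []")
  case False
  note row = joint_row_props[OF assms False]
  have "joint_expertise G (set C) s = real (joint_row M C ! s)" if "s < m" for s
    using row that False
      mono_Max_commute[of real "(\<lambda>i. M ! i ! s) ` set C"]
    by (simp add: joint_expertise_def image_image mono_def)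
  then have "joint_utility G (set C) = (\<Sum>s<m. real (joint_row M C ! s))"
    using False by (simp add: joint_utility_def)
  then show ?thesis
    using row by (simp add: total_eq_sum_list sum_list_sum_nth atLeast0LessThan)
qed (simp add: joint_utility_def)

lemma utility_mono:
  assumes "set C \<subseteq> set D" "set D \<subseteq> {..<length M}"
  shows "utility M C \<le> utility M D"
  using joint_utility_mono[OF zero_beta assms(1)] assms joint_utility_eq[of C] joint_utility_eq[of D]
  by (simp del: utility.simps)

lemma utility_le:
  assumes "set C \<subseteq> {..<length M}"
  shows "utility M C \<le> \<beta> * m"
proof -
  have "real (utility M C) \<le> real (\<beta> * m)"
    using joint_utility_le[OF zero_beta, of "set C"] assms joint_utility_eq[OF assms] by simp
  then show ?thesis
    by linarith
qed

text \<open>\<open>C\<close> may be empty, in which case \<open>coalitions\<close> drops it and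
  every coalition is full. The strict bound on its length makes it the only possible target of a
  move.\<close>

definition valid :: "nat list \<Rightarrow> nat list list \<Rightarrow> bool" where
  "valid C Fs \<longleftrightarrow> distinct (concat (C # Fs)) \<and> set (concat (C # Fs)) = {..<length M} \<and>
     length C < \<kappa> \<and> (\<forall>F\<in>set Fs. length F = \<kappa>)"

lemma valid_nonempty: "valid C Fs \<Longrightarrow> [] \<notin> set Fs"
  using size_bound_pos by (auto simp: valid_def)

lemma coalitions_valid:
  "valid C Fs \<Longrightarrow> coalitions (C, Fs) = set ` set (filter (\<lambda>X. X \<noteq> []) (C # Fs))"
  using valid_nonempty by auto

lemma valid_distinct: "valid C Fs \<Longrightarrow> F \<in> set (C # Fs) \<Longrightarrow> distinct F"
  by (auto simp: valid_def distinct_concat_iff)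

lemma valid_subset: "valid C Fs \<Longrightarrow> F \<in> set (C # Fs) \<Longrightarrow> set F \<subseteq> {..<length M}"
  unfolding valid_def by fastforce

lemma partition_on_coalitions:
  assumes "valid C Fs"
  shows "partition_on {..<length M} (coalitions (C, Fs))"
proof -
  have "concat (filter (\<lambda>X. X \<noteq> []) xss) = concat xss" for xss :: "nat list list"
    by (induction xss) auto
  then show ?thesis
    unfolding coalitions_valid[OF assms]
    using assms partition_on_concat[of "filter (\<lambda>X. X \<noteq> []) (C # Fs)"]
    unfolding valid_def by (metis (mono_tags, lifting) mem_Collect_eq set_filter)
qed

lemma card_coalition_valid:
  assumes "valid C Fs" "X \<in> coalitions (C, Fs)"
  shows "X = set C \<and> C \<noteq> [] \<and> card X < \<kappa> \<or> (\<exists>F\<in>set Fs. X = set F \<and> card X = \<kappa>)"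
proof -
  have "X \<in> set ` set (C # Fs)" "X \<noteq> {}"
    using assms(2) by simp_all
  then obtain F where F: "F \<in> set (C # Fs)" "X = set F" "F \<noteq> []"
    by blast
  then have "card X = length F"
    using distinct_card[OF valid_distinct[OF assms(1)]] by blast
  then show ?thesis
    using F assms(1) by (auto simp: valid_def)
qed

lemma is_solution_valid:
  assumes "valid C Fs"
  shows "is_solution G (coalitions (C, Fs))"
proof -
  note part = partition_on_coalitions[OF assms]
  have "is_coalition G X" if X: "X \<in> coalitions (C, Fs)" for X
  proof -
    have "X \<subseteq> {..<length M}" "X \<noteq> {}"
      using X partition_onD1[OF part] partition_onD3[OF part] by blast+
    moreover have "card X \<le> \<kappa>"
      using card_coalition_valid[OF assms X] by auto
    ultimately show ?thesis
      by (simp add: is_coalition_def)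
  qed
  then show ?thesis
    using part by (simp add: is_solution_def del: coalitions.simps)
qed

lemma almost_full_valid:
  assumes "valid C Fs"
  shows "almost_full G (coalitions (C, Fs))"
  unfolding almost_full_def
proof (intro exI[of _ "set C"] ballI impI)
  fix X
  assume X: "X \<in> coalitions (C, Fs)" "X \<noteq> set C"
  show "card X = max_size G"
    using card_coalition_valid[OF assms X(1)] X(2) by (auto simp del: coalitions.simps)
qed

lemma valid_blocks: "blocks \<kappa> (length M) = (C, Fs) \<Longrightarrow> valid C Fs"
proof -
  have "case blocks \<kappa> n of (C, Fs) \<Rightarrow> distinct (concat (C # Fs)) \<and> set (concat (C # Fs)) = {..<n} \<and>
      length C < \<kappa> \<and> (\<forall>F\<in>set Fs. length F = \<kappa>)" for n
  proof (induction n)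
    case (Suc n)
    obtain C Fs where *: "blocks \<kappa> n = (C, Fs)"
      by fastforce
    have "n \<notin> set (concat (C # Fs))"
      using Suc by (simp add: *)
    then show ?case
      using Suc by (auto simp: * lessThan_Suc)
  qed (use size_bound_pos in auto)
  then show "blocks \<kappa> (length M) = (C, Fs) \<Longrightarrow> valid C Fs"
    unfolding valid_def by (metis (mono_tags, lifting) case_prod_conv)
qed

text \<open>Only \<open>C\<close> can be joined. Its own agents gain nothing there, and all others
  were tested without success by \<open>phase\<close>.\<close>

lemma nash_stable_valid:
  assumes valid: "valid C Fs" and "C = [] \<or> phase M \<kappa> C Fs = None"
  shows "nash_stable G (coalitions (C, Fs))"
  unfolding nash_stable_def
proof (intro ballI impI)
  let ?\<pi> = "coalitions (C, Fs)"
  fix i X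
  assume i: "i \<in> agents G" and X: "X \<in> ?\<pi>" "card X < max_size G"
  then have XC: "X = set C" "C \<noteq> []"
    using card_coalition_valid[OF valid X(1)] by auto
  note part = partition_on_coalitions[OF valid]
  obtain D where D: "D \<in> set (C # Fs)" "i \<in> set D" "set D \<in> ?\<pi>"
    using i part by (auto simp: partition_on_def)
  have "joint_utility G (set (i # C)) \<le> joint_utility G (set D)"
  proof (cases "D = C")
    case True
    then show ?thesis
      using D by (simp add: insert_absorb)
  next
    case False
    then have "utility M (i # C) \<le> utility M D"
      using D assms(2) XC phase_NoneD by (metis set_ConsD)
    moreover have "set (i # C) \<subseteq> {..<length M}" "set D \<subseteq> {..<length M}"
      using i valid_subset[OF valid, of C] valid_subset[OF valid D(1)] by auto
    ultimately show ?thesis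
      by (simp only: joint_utility_eq of_nat_le_iff)
  qed
  then show "joint_utility G (X \<union> {i}) \<le> joint_utility G (coalition_of ?\<pi> i)"
    using coalition_of_eq[OF part D(3,2)] XC by simp
qed

section \<open>Phases as runs of the dynamics that raise the potential\<close>

definition full_utility :: "nat list list \<Rightarrow> nat" where
  "full_utility Fs = sum_list (map (utility M) Fs)"

lemma phase_Some:
  assumes valid: "valid C Fs" and "C \<noteq> []" and ph: "phase M \<kappa> C Fs = Some (C', Fs')"
    and l: "\<not> must_imitate G l"
  shows "valid C' Fs'" "length Fs' = length Fs" "full_utility Fs < full_utility Fs'"
    "\<exists>l'. (imitative_step G)\<^sup>*\<^sup>* (coalitions (C, Fs), l) (coalitions (C', Fs'), l') \<and>
      \<not> must_imitate G l'"
proof -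
  obtain Fs1 D Fs2 i T where Fs: "Fs = Fs1 @ D # Fs2" "Fs' = Fs1 @ T # Fs2" and i: "i \<in> set D"
    and U: "utility M D < utility M (i # C)" and im: "imitate \<kappa> (i # C) (remove1 i D) = (C', T)"
    using phase_SomeE[OF ph] .
  \<comment> \<open>The number of imitations, as \<open>i\<close> has already joined
    \<open>C\<close>. Since \<open>remove1 i D\<close> has \<kappa> - 1 entries, as many agents stay
    behind as \<open>C\<close> had.\<close>
  define k where "k = \<kappa> - Suc (length C)"
  have C': "C' = drop k (remove1 i D)" and T: "T = rev (take k (remove1 i D)) @ i # C"
    using im by (simp_all add: imitate_eq k_def)
  have len: "length C < \<kappa>" "length D = \<kappa>" "length (remove1 i D) = \<kappa> - 1"
    using valid i by (auto simp: valid_def Fs length_remove1)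
  then have len': "length C' = length C" "length T = \<kappa>"
    by (auto simp: C' T k_def)
  \<comment> \<open>A phase merely redistributes the agents of \<open>C\<close> and
    \<open>D\<close>, so comparing multisets transfers distinctness and the set of agents at
    once.\<close>
  have "mset C' + mset T = mset (take k (remove1 i D) @ drop k (remove1 i D)) + mset (i # C)"
    unfolding C' T mset_append by simp
  also have "\<dots> = mset C + mset D"
    using i by simp
  finally have "mset (concat (C' # Fs')) = mset (concat (C # Fs))"
    unfolding Fs by simp
  then have "distinct (concat (C' # Fs')) = distinct (concat (C # Fs))"
    "set (concat (C' # Fs')) = set (concat (C # Fs))"
    by (metis mset_eq_imp_distinct_iff, metis mset_eq_setD)
  then show valid': "valid C' Fs'"
    using valid len' by (auto simp: valid_def Fs)
  show "length Fs' = length Fs"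
    by (simp add: Fs)
  have "utility M (i # C) \<le> utility M T"
    using valid_subset[OF valid', of T] by (intro utility_mono) (auto simp: Fs T)
  then show "full_utility Fs < full_utility Fs'"
    using U by (simp add: full_utility_def Fs del: utility.simps)
  define P where "P = set ` set (Fs1 @ Fs2)"
  have "C' \<noteq> []"
    using len' \<open>C \<noteq> []\<close> by auto
  then have co: "coalitions (C, Fs) = insert (set C) (insert (set D) P)"
    "coalitions (C', Fs') = insert (set T) (insert (set C') P)"
    using valid_nonempty[OF valid] valid_nonempty[OF valid'] \<open>C \<noteq> []\<close> by (auto simp: Fs P_def)
  have ne: "set C \<noteq> set D"
    using valid len valid_distinct[OF valid, of C] valid_distinct[OF valid, of D] distinct_card
    by (metis Fs(1) in_set_conv_decomp less_irrefl list.set_intros)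
  have dD: "distinct D" and dC: "distinct C"
    using valid_distinct[OF valid] by (auto simp: Fs)
  have "set C \<inter> set D = {}" "set C \<inter> \<Union>P = {}" "set D \<inter> \<Union>P = {}"
    using valid by (auto simp: valid_def Fs P_def)
  moreover have "set C \<notin> P" "set D \<notin> P"
    using calculation(2,3) \<open>C \<noteq> []\<close> i
    by (metis Sup_upper inf.absorb1 set_empty, metis Sup_upper inf.absorb1 empty_iff)
  ultimately have "coalitions (C, Fs) - {set C, set D} = P"
    unfolding co by auto
  then have sp: "splits (agents G) (set C) (set D) P"
    using splitsI[OF partition_on_coalitions[OF valid] _ _ ne] co(1) by (simp del: coalitions.simps)
  have "i \<notin> set C"
    using sp i by (auto simp: splits_def)
  have setD: "set (remove1 i D) = set D - {i}"
    using dD by simp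
  have "0 < length C"
    using \<open>C \<noteq> []\<close> by simp
  then have "length (remove1 i D) > 0"
    using len by linarith
  then have ne': "set D \<noteq> {i}"
    using setD by (metis Diff_cancel length_greater_0_conv set_empty)
  note sp' = splits_move[OF sp i ne'] and rel = relocate_splits[OF sp i ne', folded co(1)]
  have coi: "coalition_of (coalitions (C, Fs)) i = set D"
    using coalition_of_eq[OF partition_on_coalitions[OF valid] _ i] co(1) by (simp del: coalitions.simps)
  have sub: "set (i # C) \<subseteq> {..<length M}" "set D \<subseteq> {..<length M}"
    using sp i by (auto simp: splits_def)
  have UG: "joint_utility G (set D) < joint_utility G (set (i # C))"
    using U unfolding joint_utility_eq[OF sub(1)] joint_utility_eq[OF sub(2)] by linarith
  have br: "better_response G (coalitions (C, Fs)) i (set C)"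
    using UG sub len dC unfolding better_response_def coi
    by (simp add: co(1) distinct_card del: coalitions.simps)
  note unstable = not_nash_stable_if_better_response[OF this]
  have "imitative_step G (coalitions (C, Fs), l)
      (insert (set (i # C)) (insert (set (remove1 i D)) P), Some (i, set D, set C))"
    using imitative_step.free[OF unstable l br] by (simp only: rel coi setD list.set(2))
  moreover have "\<exists>l'. (imitative_step G)\<^sup>*\<^sup>*
      (insert (set (i # C)) (insert (set (remove1 i D)) P), Some (i, set D, set C))
      (insert (set T) (insert (set C') P), l') \<and> \<not> must_imitate G l'"
  proof (rule imitate_reaches[OF zero_beta _ _ _ _ _ _ _ refl])
    show "splits (agents G) (set (i # C)) (set (remove1 i D)) P"
      using sp' setD by simp
    show "joint_utility G (set (remove1 i D)) < joint_utility G (set (i # C))"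
      using UG joint_utility_mono[OF zero_beta, of "set (remove1 i D)" "set D"] sub setD by auto
    show "imitate (max_size G) (i # C) (remove1 i D) = (C', T)"
      using im by simp
    show "max_size G < length (i # C) + length (remove1 i D)"
      using len \<open>0 < length C\<close> by simp
  qed (use dC dD \<open>i \<notin> set C\<close> len(1) setD in simp_all)
  ultimately show "\<exists>l'. (imitative_step G)\<^sup>*\<^sup>* (coalitions (C, Fs), l) (coalitions (C', Fs'), l') \<and>
      \<not> must_imitate G l'"
    unfolding co(2) by (meson converse_rtranclp_into_rtranclp)
qed

lemma full_utility_le:
  assumes "valid C Fs"
  shows "full_utility Fs \<le> length Fs * (\<beta> * m)"
proof -
  have "\<forall>F\<in>set Fs. utility M F \<le> \<beta> * m"
    using valid_subset[OF assms] utility_le by (metis list.set_intros(2))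
  then show ?thesis
    unfolding full_utility_def by (induction Fs) (auto simp del: utility.simps)
qed

lemma length_Fs_le:
  assumes "valid C Fs"
  shows "length Fs \<le> length M"
proof -
  have "length (concat (C # Fs)) = length M"
    using assms distinct_card[of "concat (C # Fs)"] by (simp add: valid_def)
  moreover have "[] \<notin> set Fs \<Longrightarrow> length Fs \<le> length (concat Fs)"
  proof (induction Fs)
    case (Cons F Fs)
    then have "1 \<le> length F"
      by (cases F) auto
    then show ?case
      using Cons by simp
  qed simp
  ultimately show ?thesis
    using valid_nonempty[OF assms] by simp
qed

lemma must_imitate_None: "\<not> must_imitate G None"
  by simp

text \<open>Each successful phase lowers the deficit
  \<open>length Fs * (\<beta> * m) - full_utility Fs\<close>, so at most \<open>k\<close> phases
  succeed, and the final call accounts for \<open>k + 1\<close>. The 1 added to \<open>W\<close> is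
  the step of the call itself. Exhibiting \<open>Some T\<close> includes termination. The last move
  \<open>l\<close> is arbitrary up to forcing no imitation, because later phases start after
  recorded moves.\<close>

lemma run_phases_correct:
  assumes W: "\<And>C Fs. valid C Fs \<Longrightarrow> T_phase M \<kappa> C Fs \<le> W"
    and "valid C Fs" "\<not> must_imitate G l" "length Fs * (\<beta> * m) - full_utility Fs \<le> k"
  shows "\<exists>C' Fs' l' T. run_phases M \<kappa> C Fs = (C', Fs') \<and> valid C' Fs' \<and>
    nash_stable G (coalitions (C', Fs')) \<and>
    (imitative_step G)\<^sup>*\<^sup>* (coalitions (C, Fs), l) (coalitions (C', Fs'), l') \<and>
    T_run_phases M \<kappa> C Fs = Some T \<and> T \<le> (k + 1) * (W + 1)"
  using assms(2-)
proof (induction k arbitrary: C Fs l rule: less_induct)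
  case (less k)
  show ?case
  proof (cases "C = [] \<or> phase M \<kappa> C Fs = None")
    case True
    then have "run_phases M \<kappa> C Fs = (C, Fs)"
      "T_run_phases M \<kappa> C Fs = Some (if C = [] then 1 else T_phase M \<kappa> C Fs + 1)"
      by (subst run_phases.simps T_run_phases.simps; auto)+
    moreover have "(if C = [] then 1 else T_phase M \<kappa> C Fs + 1) \<le> (k + 1) * (W + 1)"
      using W[OF less.prems(1)] by (auto simp: algebra_simps)
    ultimately show ?thesis
      using less.prems(1) nash_stable_valid[OF less.prems(1) True] by blast
  next
    case False
    then obtain C1 Fs1 where ph: "phase M \<kappa> C Fs = Some (C1, Fs1)" and "C \<noteq> []"
      by auto
    note phase = phase_Some[OF less.prems(1) \<open>C \<noteq> []\<close> ph less.prems(2)]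
    obtain l1 where l1: "(imitative_step G)\<^sup>*\<^sup>* (coalitions (C, Fs), l) (coalitions (C1, Fs1), l1)"
      "\<not> must_imitate G l1"
      using phase(4) by blast
    \<comment> \<open>The subtraction is truncated; \<open>full_utility_le\<close> for the new lists
      ensures that the old deficit was positive and really drops.\<close>
    have k: "0 < k" "length Fs1 * (\<beta> * m) - full_utility Fs1 \<le> k - 1"
      using phase(2,3) full_utility_le[OF phase(1)] less.prems(3) by auto
    then obtain C' Fs' l' T where IH: "run_phases M \<kappa> C1 Fs1 = (C', Fs')" "valid C' Fs'"
      "nash_stable G (coalitions (C', Fs'))"
      "(imitative_step G)\<^sup>*\<^sup>* (coalitions (C1, Fs1), l1) (coalitions (C', Fs'), l')"
      "T_run_phases M \<kappa> C1 Fs1 = Some T" "T \<le> (k - 1 + 1) * (W + 1)"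
      using less.IH[of "k - 1", OF _ phase(1) l1(2)] by fastforce
    have "run_phases M \<kappa> C Fs = (C', Fs')"
      by (subst run_phases.simps) (simp add: ph \<open>C \<noteq> []\<close> IH)
    moreover have "T_run_phases M \<kappa> C Fs = Some (T_phase M \<kappa> C Fs + T + 1)"
      by (subst T_run_phases.simps) (simp add: ph \<open>C \<noteq> []\<close> IH)
    moreover have "T_phase M \<kappa> C Fs + T + 1 \<le> (k + 1) * (W + 1)"
      using IH(6) W[OF less.prems(1)] k(1) by (auto simp: algebra_simps)
    ultimately show ?thesis
      using IH(2,3) l1(1) IH(4) by (meson rtranclp_trans)
  qed
qed


section \<open>Running time\<close>

text \<open>The cost of one agent in \<open>joint_row\<close>: at most \<open>length M\<close> for
  the lookup, \<open>m + 1\<close> for the maximum and 1 for the call.\<close>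

abbreviation sz :: nat where
  "sz \<equiv> length M + m + 2"

lemma T_vec_max_le: "T_vec_max xs ys \<le> length xs + 1"
  by (induction xs ys rule: T_vec_max.induct) auto

lemma T_total_eq: "T_total xs = length xs + 1"
  by (induction xs) auto

lemma T_joint_row_le:
  "set C \<subseteq> {..<length M} \<Longrightarrow> T_joint_row M C \<le> length C * sz + 1"
proof (induction C)
  case (Cons i C)
  then have "T_nth M i \<le> length M"
    by (simp add: T_nth)
  then show ?case
    using Cons T_vec_max_le[of "M ! i" "joint_row M C"] length_row[of i] by auto
qed simp

lemma T_utility_le:
  assumes "set C \<subseteq> {..<length M}" "distinct C"
  shows "T_utility M C \<le> sz * sz"
proof -
  have "T_total (joint_row M C) \<le> m + 1"
    using joint_row_props[OF assms(1)] by (cases "C = []") (auto simp: T_total_eq)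
  then have "T_utility M C \<le> length C * sz + sz"
    using T_joint_row_le[OF assms(1)] by simp
  also have "\<dots> = Suc (length C) * sz"
    by simp
  also have "\<dots> \<le> sz * sz"
    using assms card_mono[of "{..<length M}" "set C"]
    by (intro mult_right_mono) (auto simp: distinct_card)
  finally show ?thesis .
qed

lemma T_find_agent_le:
  "\<forall>i\<in>set D. T_utility M (i # C) \<le> B \<Longrightarrow> T_find_agent M C u D \<le> length D * (B + 1) + 1"
  by (induction D) (auto simp del: T_utility.simps utility.simps simp: algebra_simps)

lemma T_delete_le: "T_delete i D \<le> length D + 1"
  by (induction D) auto

text \<open>Each transfer costs \<open>length C + 2\<close>, and \<open>length C + length D\<close>
  is constant during the recursion.\<close>

lemma T_imitate_le: "T_imitate k C D \<le> length D * (length C + length D + 2) + 1"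
proof (induction D arbitrary: C)
  case (Cons i D)
  show ?case
    using Cons[of "i # C"] by (auto simp: T_length algebra_simps)
qed simp

lemma length_le:
  assumes "distinct xs" "set xs \<subseteq> {..<length M}"
  shows "length xs \<le> length M"
  using card_mono[OF _ assms(2)] assms(1) by (simp add: distinct_card)

text \<open>The assumption treats each \<open>D\<close> separately because \<open>valid\<close> is
  not inherited by the tail of \<open>Fs\<close>. For one \<open>D\<close>, evaluating, searching,
  moving and the call itself each cost at most \<open>sz ^ 3\<close>; the factor 5 leaves
  slack.\<close>

lemma T_phase_le:
  assumes "\<forall>D\<in>set Fs. distinct (C @ D) \<and> set (C @ D) \<subseteq> {..<length M}"
  shows "T_phase M \<kappa> C Fs \<le> length Fs * (5 * sz ^ 3) + 1"
  using assms
proof (induction Fs)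
  case (Cons D Fs)
  let ?u = "utility M D"
  have D: "distinct (C @ D)" "set (C @ D) \<subseteq> {..<length M}"
    using Cons.prems by auto
  have len: "length C + length D \<le> length M"
    using length_le[OF D] by simp
  have U: "T_utility M D \<le> sz * sz"
    using D by (intro T_utility_le) auto
  have "\<forall>i\<in>set D. T_utility M (i # C) \<le> sz * sz"
    using D by (intro ballI T_utility_le) auto
  then have "T_find_agent M C ?u D \<le> length D * (sz * sz + 1) + 1"
    by (rule T_find_agent_le)
  also have "\<dots> \<le> length M * (sz * sz + 1) + 1"
    using len by (intro add_mono mult_right_mono) auto
  also have "\<dots> \<le> sz ^ 3"
    by (simp add: power3_eq_cube algebra_simps)
  finally have F: "T_find_agent M C ?u D \<le> sz ^ 3" .
  have I: "T_delete i D + T_imitate \<kappa> (i # C) (delete i D) \<le> sz * sz" if "i \<in> set D" for i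
  proof -
    have "length D = Suc (length (delete i D))"
      using that length_pos_if_in_set[OF that]
      by (simp add: delete_eq_remove1 length_remove1 del: length_greater_0_conv)
    then have "length (delete i D) + length (i # C) \<le> length M"
      using len by simp
    moreover from this have "length (delete i D) * (length (i # C) + length (delete i D) + 2)
        \<le> length M * (length M + 2)"
      by (intro mult_mono) auto
    ultimately have "T_imitate \<kappa> (i # C) (delete i D) \<le> length M * (length M + 2) + 1"
      using T_imitate_le[of \<kappa> "i # C" "delete i D"] by linarith
    moreover have "T_delete i D \<le> length M + 1"
      using T_delete_le[of i D] len by linarith
    ultimately show ?thesis
      by (simp add: algebra_simps)
  qed
  define Y where "Y = sz ^ 3"
  have Y: "sz * sz \<le> Y" "1 \<le> Y"
    by (simp_all add: power3_eq_cube Y_def)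
  have IH: "T_phase M \<kappa> C Fs \<le> length Fs * (5 * Y) + 1"
    unfolding Y_def using Cons.prems by (intro Cons.IH) simp
  show ?case
  proof (cases "find_agent M C ?u D")
    case None
    then have "T_phase M \<kappa> C (D # Fs) = T_utility M D + T_find_agent M C ?u D + T_phase M \<kappa> C Fs + 1"
      by (simp del: T_utility.simps utility.simps)
    also have "\<dots> \<le> length (D # Fs) * (5 * Y) + 1"
      using U F[folded Y_def] IH Y by simp
    finally show ?thesis
      unfolding Y_def .
  next
    case (Some i)
    then have "T_phase M \<kappa> C (D # Fs) = T_utility M D + T_find_agent M C ?u D +
        (T_delete i D + T_imitate \<kappa> (i # C) (delete i D)) + 1"
      by (simp del: T_utility.simps utility.simps)
    also have "\<dots> \<le> length (D # Fs) * (5 * Y) + 1"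
      using U F[folded Y_def] I find_agent_SomeD[OF Some] Y by fastforce
    finally show ?thesis
      unfolding Y_def .
  qed
qed simp

lemma T_phase_valid_le:
  assumes "valid C Fs"
  shows "T_phase M \<kappa> C Fs \<le> 5 * sz ^ 4 + 1"
proof -
  have eq: "z * (5 * z ^ 3) = 5 * z ^ 4" for z :: nat
    by (simp add: power4_eq_xxxx power3_eq_cube)
  have "distinct (C @ D) \<and> set (C @ D) \<subseteq> {..<length M}" if "D \<in> set Fs" for D
    using assms that valid_distinct[OF assms, of D] valid_subset[OF assms, of D]
      valid_subset[OF assms, of C]
    unfolding valid_def by fastforce
  then have "T_phase M \<kappa> C Fs \<le> length Fs * (5 * sz ^ 3) + 1"
    by (intro T_phase_le) blast
  also have "\<dots> \<le> sz * (5 * sz ^ 3) + 1"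
    using length_Fs_le[OF assms] by (intro add_mono mult_right_mono) auto
  finally show ?thesis
    by (simp only: eq)
qed

lemma T_blocks_le: "T_blocks k n \<le> n * (n + 2) + 1"
proof -
  have len: "case blocks k n of (C, Fs) \<Rightarrow> length C \<le> n" for n
    by (induction n) (auto split: prod.splits)
  show ?thesis
  proof (induction n)
    case (Suc n)
    then show ?case
      using len[of n] by (auto simp: T_length split: prod.splits)
  qed simp
qed

text \<open>The witness for \<open>\<pi>\<^sub>0\<close> is the partition built by
  \<open>blocks\<close>. There are at most \<open>length M\<close> full lists, so the initial
  deficit is at most \<open>\<beta> * sz ^ 2\<close>, and \<open>5 * sz ^ 4 + 1\<close> is the bound
  for one phase.\<close>

lemma find_stable_correct:
  "\<exists>C Fs l t T \<pi>\<^sub>0. find_stable M \<kappa> = (C, Fs) \<and> valid C Fs \<and> nash_stable G (coalitions (C, Fs)) \<and>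
    is_solution G \<pi>\<^sub>0 \<and> almost_full G \<pi>\<^sub>0 \<and> reaches_in G \<pi>\<^sub>0 t (coalitions (C, Fs)) l \<and>
    T_find_stable M \<kappa> = Some T \<and> T \<le> sz * sz + (\<beta> * sz ^ 2 + 1) * (5 * sz ^ 4 + 2)"
proof -
  obtain C\<^sub>0 Fs\<^sub>0 where bl: "blocks \<kappa> (length M) = (C\<^sub>0, Fs\<^sub>0)"
    by fastforce
  note valid = valid_blocks[OF bl]
  have "length Fs\<^sub>0 * (\<beta> * m) \<le> sz * (\<beta> * sz)"
    using length_Fs_le[OF valid] by (intro mult_mono) auto
  then have le: "length Fs\<^sub>0 * (\<beta> * m) - full_utility Fs\<^sub>0 \<le> \<beta> * sz ^ 2"
    unfolding power2_eq_square mult.left_commute[of sz \<beta>] by (rule order_trans[OF diff_le_self])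
  obtain C Fs l T where run: "run_phases M \<kappa> C\<^sub>0 Fs\<^sub>0 = (C, Fs)" "valid C Fs"
    "nash_stable G (coalitions (C, Fs))"
    "(imitative_step G)\<^sup>*\<^sup>* (coalitions (C\<^sub>0, Fs\<^sub>0), None) (coalitions (C, Fs), l)"
    "T_run_phases M \<kappa> C\<^sub>0 Fs\<^sub>0 = Some T" "T \<le> (\<beta> * sz ^ 2 + 1) * (5 * sz ^ 4 + 1 + 1)"
    using run_phases_correct[where W = "5 * sz ^ 4 + 1", OF _ valid must_imitate_None le] T_phase_valid_le
    by (metis (no_types, lifting))
  obtain t where "reaches_in G (coalitions (C\<^sub>0, Fs\<^sub>0)) t (coalitions (C, Fs)) l"
    using rtranclp_imp_relpowp[OF run(4)] by blast
  moreover have "find_stable M \<kappa> = (C, Fs)"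
    by (simp add: find_stable_def bl run)
  moreover have "T_find_stable M \<kappa> = Some (T_length M + T_blocks \<kappa> (length M) + T)"
    by (simp add: T_find_stable_def bl run)
  moreover have "T_length M + T_blocks \<kappa> (length M) + T
      \<le> sz * sz + (\<beta> * sz ^ 2 + 1) * (5 * sz ^ 4 + 2)"
  proof (rule add_mono)
    show "T_length M + T_blocks \<kappa> (length M) \<le> sz * sz"
      using T_blocks_le[of \<kappa> "length M"] by (simp add: T_length algebra_simps)
    have "5 * sz ^ 4 + 1 + 1 = 5 * sz ^ 4 + 2"
      by simp
    then show "T \<le> (\<beta> * sz ^ 2 + 1) * (5 * sz ^ 4 + 2)"
      using run(6) by (simp only:)
  qed
  ultimately show ?thesis
    using run(2,3) is_solution_valid[OF valid] almost_full_valid[OF valid] by blast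
qed

end

theorem theorem2:
  fixes \<beta> :: nat
  assumes "0 < \<beta>"
  shows
    "(\<exists>K :: nat. \<forall>(G :: ('a, 's) heg) \<pi>\<^sub>0.
        is_zero_beta_heg \<beta> G \<and> is_solution G \<pi>\<^sub>0 \<and> almost_full G \<pi>\<^sub>0 \<longrightarrow>
          (\<forall>t \<pi> l. reaches_in G \<pi>\<^sub>0 t \<pi> l \<longrightarrow> t \<le> K * (card (agents G) * card (skills G))) \<and>
          (\<forall>t \<pi> l. reaches_in G \<pi>\<^sub>0 t \<pi> l \<and> (\<nexists>st. imitative_step G (\<pi>, l) st) \<longrightarrow>
             is_solution G \<pi> \<and> nash_stable G \<pi>)) \<and>
     (\<exists>p :: nat poly. \<forall>M m \<kappa>. is_matrix_instance \<beta> M m \<kappa> \<longrightarrow>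
        (let G = matrix_heg M m \<kappa>; \<pi> = coalitions (find_stable M \<kappa>) in
          is_solution G \<pi> \<and> nash_stable G \<pi> \<and>
          (\<exists>\<pi>\<^sub>0 t l. is_solution G \<pi>\<^sub>0 \<and> almost_full G \<pi>\<^sub>0 \<and> reaches_in G \<pi>\<^sub>0 t \<pi> l) \<and>
          (\<exists>T. T_find_stable M \<kappa> = Some T \<and> T \<le> poly p (length M + m))))"
proof (intro conjI)
  show "\<exists>K :: nat. \<forall>(G :: ('a, 's) heg) \<pi>\<^sub>0.
        is_zero_beta_heg \<beta> G \<and> is_solution G \<pi>\<^sub>0 \<and> almost_full G \<pi>\<^sub>0 \<longrightarrow>
          (\<forall>t \<pi> l. reaches_in G \<pi>\<^sub>0 t \<pi> l \<longrightarrow> t \<le> K * (card (agents G) * card (skills G))) \<and>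
          (\<forall>t \<pi> l. reaches_in G \<pi>\<^sub>0 t \<pi> l \<and> (\<nexists>st. imitative_step G (\<pi>, l) st) \<longrightarrow>
             is_solution G \<pi> \<and> nash_stable G \<pi>)"
    using dyn_inv_reaches dyn_inv_moves_le is_solution_dyn_inv nash_stable_if_stuck
    by (intro exI[of _ \<beta>]) blast
  \<comment> \<open>\<open>q\<close> is x + 2, whose value at \<open>length M + m\<close> is the
    size measure \<open>sz\<close>; \<open>p\<close> is the time bound of
    \<open>find_stable_correct\<close> rewritten in \<open>q\<close>.\<close>
  define q :: "nat poly" where "q = [:2, 1:]"
  define p :: "nat poly" where "p = q * q + ([:\<beta>:] * q ^ 2 + 1) * ([:5:] * q ^ 4 + [:2:])"
  have p: "poly p (length M + m) = (length M + m + 2) * (length M + m + 2) +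
      (\<beta> * (length M + m + 2) ^ 2 + 1) * (5 * (length M + m + 2) ^ 4 + 2)"
    for M :: "nat list list" and m
    by (simp add: p_def q_def add.commute)
  show "\<exists>p :: nat poly. \<forall>M m \<kappa>. is_matrix_instance \<beta> M m \<kappa> \<longrightarrow>
        (let G = matrix_heg M m \<kappa>; \<pi> = coalitions (find_stable M \<kappa>) in
          is_solution G \<pi> \<and> nash_stable G \<pi> \<and>
          (\<exists>\<pi>\<^sub>0 t l. is_solution G \<pi>\<^sub>0 \<and> almost_full G \<pi>\<^sub>0 \<and> reaches_in G \<pi>\<^sub>0 t \<pi> l) \<and>
          (\<exists>T. T_find_stable M \<kappa> = Some T \<and> T \<le> poly p (length M + m)))"
  proof (intro exI[of _ p] allI impI)
    fix M m \<kappa>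
    assume "is_matrix_instance \<beta> M m \<kappa>"
    then interpret matrix_instance \<beta> M m \<kappa>
      by unfold_locales
    show "let G = matrix_heg M m \<kappa>; \<pi> = coalitions (find_stable M \<kappa>) in
          is_solution G \<pi> \<and> nash_stable G \<pi> \<and>
          (\<exists>\<pi>\<^sub>0 t l. is_solution G \<pi>\<^sub>0 \<and> almost_full G \<pi>\<^sub>0 \<and> reaches_in G \<pi>\<^sub>0 t \<pi> l) \<and>
          (\<exists>T. T_find_stable M \<kappa> = Some T \<and> T \<le> poly p (length M + m))"
      using find_stable_correct is_solution_valid unfolding Let_def p by metis
  qed
qed

end
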